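(* Assume conditions A, D' and E' hold for the semi-Markov processes $\eta^{(\varepsilon)}(t)$, $\varepsilon\in(0,\varepsilon_0]$, together with the paper's standing regularity conditions on the semi-Markov kernels, and let $\delta^*=\min_{i\in\mathbb{X},\,j\in\mathbb{Y}_i}(\delta_{ij}\wedge\dot\delta_{ij})$. Then for every $i\in\mathbb{X}$ the stationary probability $\pi_i(\varepsilon)$ admits a pivotal Taylor expansion with a power-type remainder bound of exponent $\delta^*$: there exist integers $0\le n^-_i\le n^+_i$, reals $c_i[l]$, $n^-_i\le l\le n^+_i$, with $c_i[n^-_i]\ne0$, and constants $G^*_i\in(0,\infty)$, $\varepsilon_i\in(0,\varepsilon_0]$ such that $\big|\pi_i(\varepsilon)-\sum_{l=n^-_i}^{n^+_i}c_i[l]\varepsilon^l\big|\le G^*_i\varepsilon^{n^+_i+\delta^*}$ for $0<\varepsilon\le\varepsilon_i$.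
   Context: Let $\mathbb{X}=\{1,\dots,N\}$, $0<\varepsilon_0\le1$. For each $\varepsilon\in(0,\varepsilon_0]$, $\eta^{(\varepsilon)}(t)$ is a semi-Markov process on $\mathbb{X}$ with jump times $0=\tau_0<\tau_1<\cdots$, embedded Markov chain $\eta_n=\eta^{(\varepsilon)}(\tau_n)$, sojourn times $\kappa_{n+1}=\tau_{n+1}-\tau_n$ and semi-Markov transition probabilities $Q^{(\varepsilon)}_{ij}(t)=P(\eta_{n+1}=j,\kappa_{n+1}\le t\mid\eta_n=i)$; $p_{ij}(\varepsilon)=Q^{(\varepsilon)}_{ij}(\infty)$ and $e_{ij}(\varepsilon)=\int_0^\infty t\,Q^{(\varepsilon)}_{ij}(dt)$ (finite). The paper also assumes standing regularity conditions on $Q^{(\varepsilon)}_{ij}$ guaranteeing a well-defined process with finite $e_{ij}$. Let $e_i(\varepsilon)=\sum_{j\in\mathbb{X}}e_{ij}(\varepsilon)$ (expected sojourn time in $i$), $E_{ii}(\varepsilon)$ the expectation of $\tau_{\nu_i}$, $\nu_i=\min\{n\ge1:\eta_n=i\}$, for the process started at $\eta_0=i$, and $\pi_i(\varepsilon)=e_i(\varepsilon)/E_{ii}(\varepsilon)$, the stationary (long-run time-average) probability of state $i$. Condition A: there are nonempty $\mathbb{Y}_i\subseteq\mathbb{X}$ with (a) $p_{ij}(\varepsilon)>0$ for $j\in\mathbb{Y}_i$; (b) $p_{ij}(\varepsilon)=0$ for $j\notin\mathbb{Y}_i$; (c) for all $i,j$ there are $n\ge1$ and $i=l_0,\dots,l_n=j$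 with $l_m\in\mathbb{Y}_{l_{m-1}}$. Condition D': for $j\in\mathbb{Y}_i$, $p_{ij}(\varepsilon)=\sum_{l=l^-_{ij}}^{l^+_{ij}}a_{ij}[l]\varepsilon^l+o_{ij}(\varepsilon)$ with integers $0\le l^-_{ij}\le l^+_{ij}$, $a_{ij}[l^-_{ij}]>0$, $|o_{ij}(\varepsilon)|\le G_{ij}\varepsilon^{l^+_{ij}+\delta_{ij}}$ for $0<\varepsilon\le\varepsilon_{ij}$, $\delta_{ij}\in(0,1]$, $G_{ij}\in(0,\infty)$, $\varepsilon_{ij}\in(0,\varepsilon_0]$. Condition E': for $j\in\mathbb{Y}_i$, $e_{ij}(\varepsilon)=\sum_{l=m^-_{ij}}^{m^+_{ij}}b_{ij}[l]\varepsilon^l+\dot o_{ij}(\varepsilon)$ with integers $m^-_{ij}\le m^+_{ij}$, $b_{ij}[m^-_{ij}]>0$, $|\dot o_{ij}(\varepsilon)|\le\dot G_{ij}\varepsilon^{m^+_{ij}+\dot\delta_{ij}}$ for $0<\varepsilon\le\dot\varepsilon_{ij}$, $\dot\delta_{ij}\in(0,1]$, $\dot G_{ij}\in(0,\infty)$, $\dot\varepsilon_{ij}\in(0,\varepsilon_0]$. *)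

theory Defs
  imports "HOL-Analysis.Analysis"
begin

text \<open>Semi-Markov transition kernels: for each perturbation parameter eps and states i j,
  Q eps i j is the (finite, sub-probability) measure on the real line with distribution
  function t \<mapsto> Q_ij^(eps)(t) = P(eta_(n+1) = j, kappa_(n+1) \<le> t | eta_n = i).\<close>

type_synonym smkernel = "real \<Rightarrow> nat \<Rightarrow> nat \<Rightarrow> real measure"

definition smp :: "smkernel \<Rightarrow> real \<Rightarrow> nat \<Rightarrow> nat \<Rightarrow> real" where
  "smp Q eps i j = measure (Q eps i j) UNIV"

definition sme :: "smkernel \<Rightarrow> real \<Rightarrow> nat \<Rightarrow> nat \<Rightarrow> real" where
  "sme Q eps i j = integral\<^sup>L (Q eps i j) (\<lambda>t. t)"

definition sme_state :: "nat \<Rightarrow> smkernel \<Rightarrow> real \<Rightarrow> nat \<Rightarrow> real" where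
  "sme_state N Q eps i = (\<Sum>j\<in>{1..N}. sme Q eps i j)"

text \<open>For a path ls = [l_0,...,l_n] of the embedded chain, the expectation of
  (kappa_1 + ... + kappa_n) restricted to the event that eta_0..eta_n follow the path,
  given eta_0 = l_0:  sum_k e_(l_(k-1) l_k) * prod_(m \<noteq> k) p_(l_(m-1) l_m).\<close>
definition path_time :: "smkernel \<Rightarrow> real \<Rightarrow> nat list \<Rightarrow> real" where
  "path_time Q eps ls =
     (\<Sum>k<length ls - 1. sme Q eps (ls ! k) (ls ! Suc k) *
        (\<Prod>m\<in>{..<length ls - 1} - {k}. smp Q eps (ls ! m) (ls ! Suc m)))"

text \<open>E_ii = expectation of tau_(nu_i) for the process started at i, written out as the sum
  over n = nu_i (n = Suc k) and over the paths i, l_1, ..., l_k, i with l_1..l_k \<noteq> i.\<close>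
definition sm_return_time :: "nat \<Rightarrow> smkernel \<Rightarrow> real \<Rightarrow> nat \<Rightarrow> real" where
  "sm_return_time N Q eps i =
     (\<Sum>k. \<Sum>xs\<in>{xs. set xs \<subseteq> {1..N} - {i} \<and> length xs = k}. path_time Q eps (i # xs @ [i]))"

definition sm_stat :: "nat \<Rightarrow> smkernel \<Rightarrow> real \<Rightarrow> nat \<Rightarrow> real" where
  "sm_stat N Q eps i = sme_state N Q eps i / sm_return_time N Q eps i"

end

(*
  Call f power-asymptotic of order d if f eps = eps^k (c + O(eps^d)) as eps -> 0+ with c > 0.
  Because leading coefficients are positive, no cancellation can occur, so this class is closed
  under sums, products and reciprocals.  By conditions D' and E' the transition probabilities
  and the expected transition times are power-asymptotic of order delta* (or vanish).

  The expected return time E_ii is the series over first-return paths.  It converges because,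
  by condition A, the probability of avoiding i for n steps decays geometrically, and it solves
  the linear system H j = e_j + sum_(k ~= i) p_jk H k.  Solving the equation of a state r ~= i for
  H r and substituting it into the others gives a system of the same shape on one state less,
  with p'_jk = p_jk + p_jr p_rk / (1 - p_rr) and e'_j = e_j + p_jr e_r / (1 - p_rr); here
  1 - p_rr > 0 since i is reachable from r.  Only sums, products and quotients occur, so after
  eliminating all states but i we find that E_ii, and hence pi_i = e_i / E_ii, is
  power-asymptotic.  As pi_i <= 1 its exponent k is nonnegative, and c eps^k is the required
  expansion with remainder O(eps^(k + delta* )).
*)

theory Submission
  imports Defs "HOL-Library.Landau_Symbols"
begin

section \<open>Power asymptotics at zero\<close>

definition power_asymp :: "real \<Rightarrow> (real \<Rightarrow> real) \<Rightarrow> bool" where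
  "power_asymp d f \<longleftrightarrow>
     (\<exists>c>0. \<exists>k::int. (\<lambda>x. f x / x powi k - c) \<in> O[at_right 0](\<lambda>x. x powr d))"

definition power_asymp_or_zero :: "real \<Rightarrow> (real \<Rightarrow> real) \<Rightarrow> bool" where
  "power_asymp_or_zero d f \<longleftrightarrow> power_asymp d f \<or> (\<forall>\<^sub>F x in at_right 0. f x = 0)"

lemma power_asympI:
  "c > 0 \<Longrightarrow> (\<lambda>x. f x / x powi k - c) \<in> O[at_right 0](\<lambda>x. x powr d) \<Longrightarrow> power_asymp d f"
  unfolding power_asymp_def by blast

lemma power_asympE:
  assumes "power_asymp d f"
  obtains c k where "c > 0" "(\<lambda>x. f x / x powi k - c) \<in> O[at_right 0](\<lambda>x. x powr d)"
  using assms unfolding power_asymp_def by blast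

lemma eventually_at_right_0_le_1: "\<forall>\<^sub>F x in at_right (0::real). x \<le> 1"
  unfolding eventually_at_right_field by (intro exI[of _ 1]) auto

lemma eventually_at_right_0I:
  "0 < e \<Longrightarrow> \<forall>x. 0 < x \<and> x \<le> e \<longrightarrow> P x \<Longrightarrow> \<forall>\<^sub>F x in at_right (0::real). P x"
  unfolding eventually_at_right_field by (intro exI[of _ e]) auto

lemma tendsto_imp_bigo_1: "(g \<longlongrightarrow> (c::real)) F \<Longrightarrow> g \<in> O[F](\<lambda>_. 1)"
  by (rule bigoI_tendsto[where c = c]) simp_all

lemma powr_smallo_1: "0 < d \<Longrightarrow> (\<lambda>x. x powr d) \<in> o[at_right 0](\<lambda>_. 1 :: real)"
  by (rule smalloI_tendsto) (auto intro!: tendsto_zero_powrI tendsto_ident_at eventually_at_rightI)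

lemma bigo_powr_imp_tendsto:
  fixes g :: "real \<Rightarrow> real"
  assumes "(\<lambda>x. g x - c) \<in> O[at_right 0](\<lambda>x. x powr d)" "0 < d"
  shows "(g \<longlongrightarrow> c) (at_right 0)"
proof -
  have "(\<lambda>x. g x - c) \<in> o[at_right 0](\<lambda>_. 1)"
    using landau_o.big_small_trans[OF assms(1) powr_smallo_1[OF assms(2)]] .
  then have "((\<lambda>x. g x - c) \<longlongrightarrow> 0) (at_right 0)"
    using smalloD_tendsto by fastforce
  then show ?thesis
    by (simp add: LIM_zero_iff)
qed

lemma powi_bigo_powr:
  assumes "1 \<le> m" "d \<le> 1"
  shows "(\<lambda>x. x powi m) \<in> O[at_right 0](\<lambda>x::real. x powr d)"
proof (rule bigoI[where c = 1])
  show "\<forall>\<^sub>F x in at_right 0. norm (x powi m) \<le> 1 * norm (x powr d)"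
    using eventually_at_right_less eventually_at_right_0_le_1
  proof eventually_elim
    case (elim x)
    have "x powi m \<le> x powi 1"
      using elim assms by (intro power_int_decreasing) auto
    also have "\<dots> = x powr 1" using elim by simp
    also have "\<dots> \<le> x powr d" using elim assms by (intro powr_mono') auto
    finally show ?case using elim by simp
  qed
qed

lemma power_asymp_cong:
  assumes "power_asymp d f" "\<forall>\<^sub>F x in at_right 0. f x = g x"
  shows "power_asymp d g"
proof -
  obtain c k where "c > 0" and f: "(\<lambda>x. f x / x powi k - c) \<in> O[at_right 0](\<lambda>x. x powr d)"
    using assms(1) by (rule power_asympE)
  have "\<forall>\<^sub>F x in at_right 0. f x / x powi k - c = g x / x powi k - c"
    using assms(2) by (rule eventually_mono) simp
  then have "(\<lambda>x. g x / x powi k - c) \<in> O[at_right 0](\<lambda>x. x powr d)"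
    using f by (rule landau_o.big.in_cong[THEN iffD1])
  then show ?thesis
    using \<open>c > 0\<close> by (rule power_asympI[rotated])
qed

lemma power_asymp_mult:
  assumes "0 < d" "power_asymp d f" "power_asymp d g"
  shows "power_asymp d (\<lambda>x. f x * g x)"
proof -
  obtain c1 k1 where "c1 > 0" and f: "(\<lambda>x. f x / x powi k1 - c1) \<in> O[at_right 0](\<lambda>x. x powr d)"
    using assms(2) by (rule power_asympE)
  obtain c2 k2 where "c2 > 0" and g: "(\<lambda>x. g x / x powi k2 - c2) \<in> O[at_right 0](\<lambda>x. x powr d)"
    using assms(3) by (rule power_asympE)
  have "(\<lambda>x. f x / x powi k1) \<in> O[at_right 0](\<lambda>_. 1)"
    using bigo_powr_imp_tendsto[OF f assms(1)] by (rule tendsto_imp_bigo_1)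
  with g have "(\<lambda>x. (g x / x powi k2 - c2) * (f x / x powi k1)) \<in> O[at_right 0](\<lambda>x. x powr d)"
    by (rule landau_o.big_1_mult)
  moreover have "(\<lambda>x. c2 * (f x / x powi k1 - c1)) \<in> O[at_right 0](\<lambda>x. x powr d)"
    using f \<open>c2 > 0\<close> by simp
  ultimately have bound: "(\<lambda>x. (g x / x powi k2 - c2) * (f x / x powi k1) + c2 * (f x / x powi k1 - c1))
      \<in> O[at_right 0](\<lambda>x. x powr d)"
    by (rule sum_in_bigo)
  have "\<forall>\<^sub>F x in at_right 0. (g x / x powi k2 - c2) * (f x / x powi k1) + c2 * (f x / x powi k1 - c1)
      = f x * g x / x powi (k1 + k2) - c1 * c2"
    using eventually_at_right_less by eventually_elim (simp add: power_int_add field_simps)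
  then have "(\<lambda>x. f x * g x / x powi (k1 + k2) - c1 * c2) \<in> O[at_right 0](\<lambda>x. x powr d)"
    using bound by (rule landau_o.big.in_cong[THEN iffD1])
  then show ?thesis
    using \<open>c1 > 0\<close> \<open>c2 > 0\<close> by (intro power_asympI[of "c1 * c2"]) auto
qed

lemma power_asymp_inverse:
  assumes "0 < d" "power_asymp d f"
  shows "power_asymp d (\<lambda>x. 1 / f x)"
proof -
  obtain c k where "c > 0" and f: "(\<lambda>x. f x / x powi k - c) \<in> O[at_right 0](\<lambda>x. x powr d)"
    using assms(2) by (rule power_asympE)
  define q where "q x = f x / x powi k" for x
  have q: "(\<lambda>x. q x - c) \<in> O[at_right 0](\<lambda>x. x powr d)"
    using f unfolding q_def .
  have lim: "(q \<longlongrightarrow> c) (at_right 0)"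
    using q assms(1) by (rule bigo_powr_imp_tendsto)
  have "((\<lambda>x. 1 / (c * q x)) \<longlongrightarrow> 1 / (c * c)) (at_right 0)"
    using \<open>c > 0\<close> by (intro tendsto_divide tendsto_mult tendsto_const lim) auto
  then have "(\<lambda>x. 1 / (c * q x)) \<in> O[at_right 0](\<lambda>_. 1)"
    by (rule tendsto_imp_bigo_1)
  with q have "(\<lambda>x. (q x - c) * (1 / (c * q x))) \<in> O[at_right 0](\<lambda>x. x powr d)"
    by (rule landau_o.big_1_mult)
  then have bound: "(\<lambda>x. - ((q x - c) * (1 / (c * q x)))) \<in> O[at_right 0](\<lambda>x. x powr d)"
    by simp
  have "\<forall>\<^sub>F x in at_right 0. q x > 0"
    using lim \<open>c > 0\<close> by (rule order_tendstoD)
  then have "\<forall>\<^sub>F x in at_right 0. - ((q x - c) * (1 / (c * q x))) = 1 / f x / x powi (- k) - 1 / c"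
    using eventually_at_right_less
  proof eventually_elim
    case (elim x)
    then have "x powi k > 0" "f x \<noteq> 0"
      by (auto simp: q_def)
    with elim \<open>c > 0\<close> show ?case by (simp add: q_def power_int_minus field_simps)
  qed
  then have "(\<lambda>x. 1 / f x / x powi (- k) - 1 / c) \<in> O[at_right 0](\<lambda>x. x powr d)"
    using bound by (rule landau_o.big.in_cong[THEN iffD1])
  then show ?thesis
    using \<open>c > 0\<close> by (intro power_asympI[of "1 / c"]) auto
qed

lemma power_asymp_add_ordered:
  assumes "0 < d" "d \<le> 1" "k1 \<le> k2" "c1 > 0" "c2 > 0"
    and f: "(\<lambda>x. f x / x powi k1 - c1) \<in> O[at_right 0](\<lambda>x. x powr d)"
    and g: "(\<lambda>x. g x / x powi k2 - c2) \<in> O[at_right 0](\<lambda>x. x powr d)"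
  shows "power_asymp d (\<lambda>x. f x + g x)"
proof (cases "k1 = k2")
  case True
  have "(\<lambda>x. (f x / x powi k1 - c1) + (g x / x powi k2 - c2)) \<in> O[at_right 0](\<lambda>x. x powr d)"
    using f g by (rule sum_in_bigo)
  then have "(\<lambda>x. (f x + g x) / x powi k1 - (c1 + c2)) \<in> O[at_right 0](\<lambda>x. x powr d)"
    using True by (simp add: add_divide_distrib algebra_simps)
  then show ?thesis
    using assms(4,5) by (intro power_asympI[of "c1 + c2"]) auto
next
  case False
  have "(\<lambda>x. g x / x powi k2) \<in> O[at_right 0](\<lambda>_. 1)"
    using bigo_powr_imp_tendsto[OF g assms(1)] by (rule tendsto_imp_bigo_1)
  moreover have "(\<lambda>x. x powi (k2 - k1)) \<in> O[at_right 0](\<lambda>x. x powr d)"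
    using False assms(2,3) by (intro powi_bigo_powr) auto
  ultimately have "(\<lambda>x. x powi (k2 - k1) * (g x / x powi k2)) \<in> O[at_right 0](\<lambda>x. x powr d)"
    by (intro landau_o.big_1_mult)
  with f have bound: "(\<lambda>x. (f x / x powi k1 - c1) + x powi (k2 - k1) * (g x / x powi k2))
      \<in> O[at_right 0](\<lambda>x. x powr d)"
    by (rule sum_in_bigo)
  have "\<forall>\<^sub>F x in at_right 0. (f x / x powi k1 - c1) + x powi (k2 - k1) * (g x / x powi k2)
      = (f x + g x) / x powi k1 - c1"
    using eventually_at_right_less
    by eventually_elim (simp add: power_int_diff add_divide_distrib)
  then have "(\<lambda>x. (f x + g x) / x powi k1 - c1) \<in> O[at_right 0](\<lambda>x. x powr d)"
    using bound by (rule landau_o.big.in_cong[THEN iffD1])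
  then show ?thesis
    using assms(4) by (rule power_asympI[rotated])
qed

lemma power_asymp_add:
  assumes "0 < d" "d \<le> 1" "power_asymp d f" "power_asymp d g"
  shows "power_asymp d (\<lambda>x. f x + g x)"
proof -
  obtain c1 k1 where "c1 > 0" and f: "(\<lambda>x. f x / x powi k1 - c1) \<in> O[at_right 0](\<lambda>x. x powr d)"
    using assms(3) by (rule power_asympE)
  obtain c2 k2 where "c2 > 0" and g: "(\<lambda>x. g x / x powi k2 - c2) \<in> O[at_right 0](\<lambda>x. x powr d)"
    using assms(4) by (rule power_asympE)
  show ?thesis
  proof (cases "k1 \<le> k2")
    case True
    show ?thesis by (rule power_asymp_add_ordered[OF assms(1,2) True \<open>c1 > 0\<close> \<open>c2 > 0\<close> f g])
  next
    case False
    have "power_asymp d (\<lambda>x. g x + f x)"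
      using False by (intro power_asymp_add_ordered[OF assms(1,2) _ \<open>c2 > 0\<close> \<open>c1 > 0\<close> g f]) auto
    then show ?thesis by (simp add: add.commute)
  qed
qed

lemma power_asymp_add_or_zero:
  assumes "0 < d" "d \<le> 1" "power_asymp d f" "power_asymp_or_zero d g"
  shows "power_asymp d (\<lambda>x. f x + g x)"
  using assms(4) unfolding power_asymp_or_zero_def
proof
  assume "power_asymp d g"
  then show ?thesis by (rule power_asymp_add[OF assms(1-3)])
next
  assume "\<forall>\<^sub>F x in at_right 0. g x = 0"
  then have "\<forall>\<^sub>F x in at_right 0. f x = f x + g x"
    by (rule eventually_mono) simp
  then show ?thesis by (rule power_asymp_cong[OF assms(3)])
qed

lemma power_asymp_or_zero_add:
  assumes "0 < d" "d \<le> 1" "power_asymp_or_zero d f" "power_asymp_or_zero d g"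
  shows "power_asymp_or_zero d (\<lambda>x. f x + g x)"
proof (cases "power_asymp d f \<or> power_asymp d g")
  case True
  then have "power_asymp d (\<lambda>x. f x + g x) \<or> power_asymp d (\<lambda>x. g x + f x)"
    using assms power_asymp_add_or_zero[OF assms(1,2)] by blast
  then show ?thesis
    unfolding power_asymp_or_zero_def by (auto simp: add.commute)
next
  case False
  then have "\<forall>\<^sub>F x in at_right 0. f x = 0 \<and> g x = 0"
    using assms(3,4) unfolding power_asymp_or_zero_def by (auto intro: eventually_conj)
  then have "\<forall>\<^sub>F x in at_right 0. f x + g x = 0"
    by (rule eventually_mono) simp
  then show ?thesis
    unfolding power_asymp_or_zero_def ..
qed

lemma power_asymp_or_zero_mult:
  assumes "0 < d" "power_asymp_or_zero d f" "power_asymp_or_zero d g"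
  shows "power_asymp_or_zero d (\<lambda>x. f x * g x)"
proof (cases "power_asymp d f \<and> power_asymp d g")
  case True
  then show ?thesis
    using power_asymp_mult[OF assms(1)] unfolding power_asymp_or_zero_def by blast
next
  case False
  then have "(\<forall>\<^sub>F x in at_right 0. f x = 0) \<or> (\<forall>\<^sub>F x in at_right 0. g x = 0)"
    using assms(2,3) unfolding power_asymp_or_zero_def by blast
  then have "\<forall>\<^sub>F x in at_right 0. f x * g x = 0"
    by (auto elim!: eventually_mono)
  then show ?thesis
    unfolding power_asymp_or_zero_def ..
qed

lemma power_asymp_or_zero_divide:
  assumes "0 < d" "power_asymp_or_zero d f" "power_asymp d g"
  shows "power_asymp_or_zero d (\<lambda>x. f x / g x)"
proof -
  have "power_asymp_or_zero d (\<lambda>x. f x * (1 / g x))"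
    using assms power_asymp_inverse[OF assms(1,3)]
    by (intro power_asymp_or_zero_mult) (auto simp: power_asymp_or_zero_def)
  then show ?thesis by simp
qed

lemma power_asymp_or_zero_sum:
  assumes "0 < d" "d \<le> 1" "\<And>a. a \<in> A \<Longrightarrow> power_asymp_or_zero d (f a)"
  shows "power_asymp_or_zero d (\<lambda>x. \<Sum>a\<in>A. f a x)"
  using assms(3)
proof (induction A rule: infinite_finite_induct)
  case (insert a A)
  then show ?case by (simp add: power_asymp_or_zero_add[OF assms(1,2)])
qed (simp_all add: power_asymp_or_zero_def)

lemma power_asymp_sum:
  assumes "0 < d" "d \<le> 1" "finite A" "a \<in> A" "power_asymp d (f a)"
    and "\<And>b. b \<in> A \<Longrightarrow> power_asymp_or_zero d (f b)"
  shows "power_asymp d (\<lambda>x. \<Sum>b\<in>A. f b x)"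
proof -
  have "power_asymp d (\<lambda>x. f a x + (\<Sum>b\<in>A - {a}. f b x))"
    using assms by (intro power_asymp_add_or_zero power_asymp_or_zero_sum) auto
  then show ?thesis
    using assms(3,4) by (simp add: sum.remove)
qed

lemma power_asymp_if_nonzero:
  assumes "power_asymp_or_zero d f" "\<forall>\<^sub>F x in at_right 0. f x \<noteq> 0"
  shows "power_asymp d f"
proof (rule ccontr)
  assume "\<not> power_asymp d f"
  then have "\<forall>\<^sub>F x in at_right 0. f x = 0"
    using assms(1) unfolding power_asymp_or_zero_def by blast
  with assms(2) have "\<forall>\<^sub>F x in at_right (0::real). False"
    by eventually_elim simp
  then show False by simp
qed

lemma remainder_bigo_powr:
  fixes r :: "real \<Rightarrow> real"
  assumes "m \<le> n" "d \<le> \<delta>"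
    and "\<forall>\<^sub>F x in at_right 0. \<bar>r x\<bar> \<le> G * x powr (real_of_int n + \<delta>)"
  shows "(\<lambda>x. r x / x powi m) \<in> O[at_right 0](\<lambda>x. x powr d)"
proof (rule bigoI[where c = "\<bar>G\<bar>"])
  show "\<forall>\<^sub>F x in at_right 0. norm (r x / x powi m) \<le> \<bar>G\<bar> * norm (x powr d)"
    using assms(3) eventually_at_right_less eventually_at_right_0_le_1
  proof eventually_elim
    case (elim x)
    have "\<bar>r x\<bar> \<le> \<bar>G\<bar> * x powr (real_of_int n + \<delta>)"
      by (rule order.trans[OF elim(1) mult_right_mono[OF abs_ge_self powr_ge_zero]])
    then have "\<bar>r x\<bar> / x powi m \<le> \<bar>G\<bar> * x powr (real_of_int n + \<delta>) / x powr real_of_int m"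
      using elim by (intro frac_le) (auto simp: powr_real_of_int')
    also have "\<dots> = \<bar>G\<bar> * x powr (real_of_int (n - m) + \<delta>)"
      by (simp add: powr_diff algebra_simps)
    also have "\<dots> \<le> \<bar>G\<bar> * x powr d"
      using elim assms(1,2) by (intro mult_left_mono powr_mono') auto
    finally show ?case using elim by (simp add: abs_divide)
  qed
qed

lemma power_asymp_of_expansion:
  fixes b :: "int \<Rightarrow> real"
  assumes "0 < d" "d \<le> \<delta>" "d \<le> 1" "m \<le> n" "b m > 0" "0 < e"
    and "\<forall>x. 0 < x \<and> x \<le> e \<longrightarrow>
      \<bar>f x - (\<Sum>l=m..n. b l * x powi l)\<bar> \<le> G * x powr (real_of_int n + \<delta>)"
  shows "power_asymp d f"
proof -
  have "\<forall>\<^sub>F x in at_right 0. \<bar>f x - (\<Sum>l=m..n. b l * x powi l)\<bar> \<le> G * x powr (real_of_int n + \<delta>)"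
    using assms(6,7) by (rule eventually_at_right_0I)
  with assms(4,2) have "(\<lambda>x. (f x - (\<Sum>l=m..n. b l * x powi l)) / x powi m) \<in> O[at_right 0](\<lambda>x. x powr d)"
    by (rule remainder_bigo_powr)
  moreover have "(\<lambda>x. \<Sum>l\<in>{m<..n}. x powi (l - m) * b l) \<in> O[at_right 0](\<lambda>x. x powr d)"
    using assms(3) by (intro big_sum_in_bigo landau_o.big_1_mult powi_bigo_powr bigo_const) auto
  ultimately have bound: "(\<lambda>x. (f x - (\<Sum>l=m..n. b l * x powi l)) / x powi m
      + (\<Sum>l\<in>{m<..n}. x powi (l - m) * b l)) \<in> O[at_right 0](\<lambda>x. x powr d)"
    by (rule sum_in_bigo)
  have split: "{m..n} = insert m {m<..n}"
    using assms(4) by auto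
  have "\<forall>\<^sub>F x in at_right 0. (f x - (\<Sum>l=m..n. b l * x powi l)) / x powi m
      + (\<Sum>l\<in>{m<..n}. x powi (l - m) * b l) = f x / x powi m - b m"
    using eventually_at_right_less
  proof eventually_elim
    case (elim x)
    have "(\<Sum>l=m..n. b l * x powi l) = b m * x powi m + (\<Sum>l\<in>{m<..n}. b l * x powi l)"
      unfolding split by simp
    moreover have "(\<Sum>l\<in>{m<..n}. x powi (l - m) * b l) = (\<Sum>l\<in>{m<..n}. b l * x powi l) / x powi m"
      using elim by (simp add: sum_divide_distrib power_int_diff mult.commute)
    ultimately show ?case
      using elim by (simp add: diff_divide_distrib add_divide_distrib)
  qed
  then have "(\<lambda>x. f x / x powi m - b m) \<in> O[at_right 0](\<lambda>x. x powr d)"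
    using bound by (rule landau_o.big.in_cong[THEN iffD1])
  then show ?thesis
    using assms(5) by (rule power_asympI[rotated])
qed

lemma power_asymp_of_nat_expansion:
  fixes a :: "nat \<Rightarrow> real"
  assumes "0 < d" "d \<le> \<delta>" "d \<le> 1" "m \<le> n" "a m > 0" "0 < e"
    and "\<forall>x. 0 < x \<and> x \<le> e \<longrightarrow> \<bar>f x - (\<Sum>l=m..n. a l * x ^ l)\<bar> \<le> G * x powr (real n + \<delta>)"
  shows "power_asymp d f"
proof (rule power_asymp_of_expansion[where b = "\<lambda>l. a (nat l)" and m = "int m" and n = "int n"])
  have "(\<Sum>l=int m..int n. a (nat l) * x powi l) = (\<Sum>l=m..n. a l * x ^ l)" for x :: real
    by (simp add: image_int_atLeastAtMost[symmetric] sum.reindex power_int_of_nat)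
  then show "\<forall>x. 0 < x \<and> x \<le> e \<longrightarrow>
      \<bar>f x - (\<Sum>l=int m..int n. a (nat l) * x powi l)\<bar> \<le> G * x powr (real_of_int (int n) + \<delta>)"
    using assms(7) by simp
qed (use assms in auto)

lemma exponent_nonneg_if_bounded_above:
  fixes f :: "real \<Rightarrow> real"
  assumes "c > 0" "((\<lambda>x. f x / x powi k) \<longlongrightarrow> c) (at_right 0)"
    and "\<forall>\<^sub>F x in at_right 0. f x \<le> B"
  shows "0 \<le> k"
proof (rule ccontr)
  assume "\<not> 0 \<le> k"
  have "((\<lambda>x. x ^ nat (- k)) \<longlongrightarrow> 0) (at_right (0::real))"
    using \<open>\<not> 0 \<le> k\<close> by (auto intro!: tendsto_eq_intros tendsto_ident_at)
  moreover have "\<forall>\<^sub>F x in at_right (0::real). 0 < x ^ nat (- k)"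
    using eventually_at_right_less by (rule eventually_mono) simp
  ultimately have "filterlim (\<lambda>x. inverse (x ^ nat (- k))) at_top (at_right (0::real))"
    by (rule filterlim_inverse_at_top)
  with assms(2,1) have "filterlim (\<lambda>x. f x / x powi k * inverse (x ^ nat (- k))) at_top (at_right 0)"
    by (rule filterlim_tendsto_pos_mult_at_top)
  moreover have "\<forall>\<^sub>F x in at_right 0. f x / x powi k * inverse (x ^ nat (- k)) = f x"
    using eventually_at_right_less
    by eventually_elim (use \<open>\<not> 0 \<le> k\<close> in \<open>simp add: power_int_def power_inverse\<close>)
  ultimately have "filterlim f at_top (at_right 0)"
    using filterlim_cong by fastforce
  then have "\<forall>\<^sub>F x in at_right 0. B + 1 \<le> f x"
    unfolding filterlim_at_top by blast
  with assms(3) have "\<forall>\<^sub>F x in at_right (0::real). False"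
    by eventually_elim simp
  then show False by simp
qed

definition pivotal_expansion :: "real \<Rightarrow> real \<Rightarrow> (real \<Rightarrow> real) \<Rightarrow> bool" where
  "pivotal_expansion d e0 f \<longleftrightarrow>
     (\<exists>nm np :: nat. \<exists>c :: nat \<Rightarrow> real. \<exists>G e :: real.
        nm \<le> np \<and> c nm \<noteq> 0 \<and> 0 < G \<and> 0 < e \<and> e \<le> e0 \<and>
        (\<forall>x. 0 < x \<and> x \<le> e \<longrightarrow> \<bar>f x - (\<Sum>l=nm..np. c l * x ^ l)\<bar> \<le> G * x powr (real np + d)))"

lemma power_asymp_bounded_imp_pivotal_expansion:
  assumes "0 < d" "power_asymp d f" "\<forall>\<^sub>F x in at_right 0. f x \<le> B" "0 < e0"
  shows "pivotal_expansion d e0 f"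
proof -
  obtain c k where "c > 0" and f: "(\<lambda>x. f x / x powi k - c) \<in> O[at_right 0](\<lambda>x. x powr d)"
    using assms(2) by (rule power_asympE)
  have "0 \<le> k"
    using \<open>c > 0\<close> bigo_powr_imp_tendsto[OF f assms(1)] assms(3)
    by (rule exponent_nonneg_if_bounded_above)
  obtain G where "G > 0" and "\<forall>\<^sub>F x in at_right 0. norm (f x / x powi k - c) \<le> G * norm (x powr d)"
    using f by (rule landau_o.bigE)
  then obtain b where "b > 0" and bound: "\<And>x. 0 < x \<Longrightarrow> x < b \<Longrightarrow> \<bar>f x / x powi k - c\<bar> \<le> G * x powr d"
    unfolding eventually_at_right_field by auto
  have "\<bar>f x - c * x ^ nat k\<bar> \<le> G * x powr (real (nat k) + d)" if "0 < x" "x \<le> min e0 (b / 2)" for x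
  proof -
    have "\<bar>f x - c * x ^ nat k\<bar> = x powi k * \<bar>f x / x powi k - c\<bar>"
      using that \<open>0 \<le> k\<close> by (simp add: power_int_def abs_mult[symmetric] field_simps)
    also have "\<dots> \<le> x powi k * (G * x powr d)"
      using that \<open>b > 0\<close> by (intro mult_left_mono bound) auto
    also have "\<dots> = G * x powr (real (nat k) + d)"
      using that \<open>0 \<le> k\<close> by (simp add: powr_add powr_real_of_int')
    finally show ?thesis .
  qed
  then show ?thesis
    unfolding pivotal_expansion_def using \<open>c > 0\<close> \<open>G > 0\<close> \<open>b > 0\<close> assms(4)
    by (intro exI[of _ "nat k"] exI[of _ "\<lambda>_. c"] exI[of _ G] exI[of _ "min e0 (b / 2)"]) auto
qed

section \<open>Eliminating states from a linear system\<close>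

text \<open>The last conjunct says that \<open>i\<close> can be reached from every state of \<open>T\<close>.\<close>

definition stochastic_reaching :: "'a set \<Rightarrow> 'a \<Rightarrow> ('a \<Rightarrow> 'a \<Rightarrow> real) \<Rightarrow> bool" where
  "stochastic_reaching T i p \<longleftrightarrow>
     (\<forall>j\<in>T. \<forall>k\<in>T. 0 \<le> p j k) \<and> (\<forall>j\<in>T. (\<Sum>k\<in>T. p j k) = 1) \<and>
     (\<forall>U \<subseteq> T - {i}. U \<noteq> {} \<longrightarrow> (\<exists>j\<in>U. \<exists>k\<in>T - U. 0 < p j k))"

lemma stochastic_reaching_exit_pos:
  assumes "stochastic_reaching T i p" "finite T" "r \<in> T" "r \<noteq> i"
  shows "0 < (\<Sum>k\<in>T - {r}. p r k)"
proof -
  have "{r} \<subseteq> T - {i}"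
    using assms(3,4) by auto
  then obtain k where k: "k \<in> T - {r}" "0 < p r k"
    using assms(1) unfolding stochastic_reaching_def by blast
  have "p r k \<le> (\<Sum>k\<in>T - {r}. p r k)"
    using assms k unfolding stochastic_reaching_def by (intro member_le_sum) auto
  with k show ?thesis by linarith
qed

lemma eliminate_preserves_exit:
  fixes p :: "'a \<Rightarrow> 'a \<Rightarrow> real"
  assumes nonneg: "\<And>j k. j \<in> T \<Longrightarrow> k \<in> T \<Longrightarrow> 0 \<le> p j k" and "s > 0" "r \<in> T" "r \<noteq> i"
    and exit: "\<And>U. U \<subseteq> T - {i} \<Longrightarrow> U \<noteq> {} \<Longrightarrow> \<exists>j\<in>U. \<exists>k\<in>T - U. 0 < p j k"
    and U: "U \<subseteq> T - {r} - {i}" "U \<noteq> {}"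
  shows "\<exists>j\<in>U. \<exists>k\<in>T - {r} - U. 0 < p j k + p j r * p r k / s"
proof -
  have le: "p j k \<le> p j k + p j r * p r k / s" if "j \<in> T" "k \<in> T" for j k
    using that nonneg[of j r] nonneg[of r k] assms(3) \<open>s > 0\<close> by (simp add: divide_nonneg_pos)
  obtain j k where jk: "j \<in> U" "k \<in> T - U" "0 < p j k"
    using exit[of U] U by blast
  show ?thesis
  proof (cases "k = r")
    case False
    then show ?thesis
      using jk U le[of j k] by (intro bexI[of _ j] bexI[of _ k]) auto
  next
    case True
    obtain j' k' where jk': "j' \<in> insert r U" "k' \<in> T - insert r U" "0 < p j' k'"
      using exit[of "insert r U"] U assms(3,4) by blast
    show ?thesis
    proof (cases "j' = r")
      case False
      then show ?thesis
        using jk' U le[of j' k'] by (intro bexI[of _ j'] bexI[of _ k']) auto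
    next
      case True
      have "0 < p j r * p r k' / s"
        using jk jk' \<open>k = r\<close> True \<open>s > 0\<close> by simp
      moreover have "0 \<le> p j k'"
        using nonneg jk jk' U by auto
      ultimately show ?thesis
        using jk jk' by (intro bexI[of _ j] bexI[of _ k']) auto
    qed
  qed
qed

lemma stochastic_reaching_eliminate:
  assumes "stochastic_reaching T i p" "finite T" "r \<in> T" "r \<noteq> i"
  defines "s \<equiv> \<Sum>k\<in>T - {r}. p r k"
  shows "stochastic_reaching (T - {r}) i (\<lambda>j k. p j k + p j r * p r k / s)"
proof -
  have nonneg: "\<And>j k. j \<in> T \<Longrightarrow> k \<in> T \<Longrightarrow> 0 \<le> p j k"
    and row: "\<And>j. j \<in> T \<Longrightarrow> (\<Sum>k\<in>T. p j k) = 1"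
    and exit: "\<And>U. U \<subseteq> T - {i} \<Longrightarrow> U \<noteq> {} \<Longrightarrow> \<exists>j\<in>U. \<exists>k\<in>T - U. 0 < p j k"
    using assms(1) unfolding stochastic_reaching_def by blast+
  have "s > 0"
    unfolding s_def using assms(1-4) by (rule stochastic_reaching_exit_pos)
  show ?thesis
    unfolding stochastic_reaching_def
  proof (intro conjI ballI allI impI)
    fix j k assume "j \<in> T - {r}" "k \<in> T - {r}"
    then show "0 \<le> p j k + p j r * p r k / s"
      using nonneg[of j k] nonneg[of j r] nonneg[of r k] assms(3) \<open>s > 0\<close> by (simp add: divide_nonneg_pos)
  next
    fix j assume j: "j \<in> T - {r}"
    have "(\<Sum>k\<in>T - {r}. p j k + p j r * p r k / s) = (\<Sum>k\<in>T - {r}. p j k) + p j r"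
      using \<open>s > 0\<close> by (simp add: sum.distrib s_def flip: sum_distrib_left sum_divide_distrib)
    also have "\<dots> = 1"
      using row[of j] j assms(2,3) by (simp add: sum.remove[of T r])
    finally show "(\<Sum>k\<in>T - {r}. p j k + p j r * p r k / s) = 1" .
  next
    fix U assume "U \<subseteq> T - {r} - {i}" "U \<noteq> {}"
    then show "\<exists>j\<in>U. \<exists>k\<in>T - {r} - U. 0 < p j k + p j r * p r k / s"
      using eliminate_preserves_exit[OF nonneg \<open>s > 0\<close> assms(3,4) exit] by blast
  qed
qed

lemma linear_system_eliminate:
  fixes p :: "'a \<Rightarrow> 'a \<Rightarrow> real"
  assumes "finite T" "r \<in> T" "r \<noteq> i" "(\<Sum>k\<in>T. p r k) = 1" "s \<noteq> 0"
    and s: "s = (\<Sum>k\<in>T - {r}. p r k)"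
    and H: "\<forall>j\<in>T. H j = e j + (\<Sum>k\<in>T - {i}. p j k * H k)"
  shows "\<forall>j\<in>T - {r}. H j = (e j + p j r * e r / s)
           + (\<Sum>k\<in>T - {r} - {i}. (p j k + p j r * p r k / s) * H k)"
proof
  have "T - {i} = insert r (T - {r} - {i})"
    using assms(2,3) by auto
  then have split: "\<And>f. (\<Sum>k\<in>T - {i}. f k) = f r + (\<Sum>k\<in>T - {r} - {i}. f k)"
    using assms(1) by simp
  have "p r r = 1 - s"
    using assms(1,2,4) s by (simp add: sum.remove[of T r])
  have "H r = e r + (\<Sum>k\<in>T - {i}. p r k * H k)"
    using H assms(2) by blast
  also have "\<dots> = e r + p r r * H r + (\<Sum>k\<in>T - {r} - {i}. p r k * H k)"
    by (simp only: split add.assoc)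
  finally have "s * H r = e r + (\<Sum>k\<in>T - {r} - {i}. p r k * H k)"
    using \<open>p r r = 1 - s\<close> by (simp add: algebra_simps)
  then have Hr: "H r = (e r + (\<Sum>k\<in>T - {r} - {i}. p r k * H k)) / s"
    using \<open>s \<noteq> 0\<close> by (simp add: field_simps)
  fix j assume "j \<in> T - {r}"
  then have "H j = e j + (\<Sum>k\<in>T - {i}. p j k * H k)"
    using H by blast
  also have "\<dots> = e j + p j r * H r + (\<Sum>k\<in>T - {r} - {i}. p j k * H k)"
    by (simp only: split add.assoc)
  also have "\<dots> = (e j + p j r * e r / s) + (\<Sum>k\<in>T - {r} - {i}. (p j k + p j r * p r k / s) * H k)"
    unfolding Hr by (simp add: field_simps sum_distrib_left sum.distrib add_divide_distrib
        sum_divide_distrib)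
  finally show "H j = (e j + p j r * e r / s) + (\<Sum>k\<in>T - {r} - {i}. (p j k + p j r * p r k / s) * H k)" .
qed

lemma power_asymp_eliminate_step:
  fixes p :: "real \<Rightarrow> 'a \<Rightarrow> 'a \<Rightarrow> real" and e H :: "real \<Rightarrow> 'a \<Rightarrow> real"
  assumes "0 < d" "d \<le> 1" "finite T" "r \<in> T" "r \<noteq> i"
    and system: "\<forall>\<^sub>F x in at_right 0. stochastic_reaching T i (p x) \<and>
      (\<forall>j\<in>T. H x j = e x j + (\<Sum>k\<in>T - {i}. p x j k * H x k))"
    and asymp_p: "\<forall>j\<in>T. \<forall>k\<in>T. power_asymp_or_zero d (\<lambda>x. p x j k)"
    and asymp_e: "\<forall>j\<in>T. power_asymp d (\<lambda>x. e x j)"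
  defines "s \<equiv> \<lambda>x. \<Sum>k\<in>T - {r}. p x r k"
  defines "p' \<equiv> \<lambda>x j k. p x j k + p x j r * p x r k / s x"
    and "e' \<equiv> \<lambda>x j. e x j + p x j r * e x r / s x"
  shows "\<forall>\<^sub>F x in at_right 0. stochastic_reaching (T - {r}) i (p' x) \<and>
      (\<forall>j\<in>T - {r}. H x j = e' x j + (\<Sum>k\<in>T - {r} - {i}. p' x j k * H x k))"
    and "\<forall>j\<in>T - {r}. \<forall>k\<in>T - {r}. power_asymp_or_zero d (\<lambda>x. p' x j k)"
    and "\<forall>j\<in>T - {r}. power_asymp d (\<lambda>x. e' x j)"
proof -
  have s_pos: "\<forall>\<^sub>F x in at_right 0. 0 < s x"
    using system by (rule eventually_mono)
      (use assms(3-5) in \<open>auto simp: s_def intro: stochastic_reaching_exit_pos\<close>)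
  have "power_asymp_or_zero d s"
    unfolding s_def using asymp_p assms(4) by (intro power_asymp_or_zero_sum assms(1,2)) auto
  moreover have "\<forall>\<^sub>F x in at_right 0. s x \<noteq> 0"
    using s_pos by (rule eventually_mono) simp
  ultimately have asymp_s: "power_asymp d s"
    by (rule power_asymp_if_nonzero)
  show "\<forall>\<^sub>F x in at_right 0. stochastic_reaching (T - {r}) i (p' x) \<and>
      (\<forall>j\<in>T - {r}. H x j = e' x j + (\<Sum>k\<in>T - {r} - {i}. p' x j k * H x k))"
    using system s_pos
  proof eventually_elim
    case (elim x)
    then have reaching: "stochastic_reaching T i (p x)"
      and eq: "\<forall>j\<in>T. H x j = e x j + (\<Sum>k\<in>T - {i}. p x j k * H x k)"
      and "s x \<noteq> 0"
      by auto
    then have row: "(\<Sum>k\<in>T. p x r k) = 1"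
      using assms(4) unfolding stochastic_reaching_def by blast
    show ?case
      unfolding p'_def e'_def s_def
      using stochastic_reaching_eliminate[OF reaching assms(3-5)]
        linear_system_eliminate[OF assms(3-5) row \<open>s x \<noteq> 0\<close>[unfolded s_def] refl eq]
      by simp
  qed
  show "\<forall>j\<in>T - {r}. \<forall>k\<in>T - {r}. power_asymp_or_zero d (\<lambda>x. p' x j k)"
    unfolding p'_def using asymp_p assms(4) asymp_s assms(1,2)
    by (auto intro!: power_asymp_or_zero_add power_asymp_or_zero_divide power_asymp_or_zero_mult)
  show "\<forall>j\<in>T - {r}. power_asymp d (\<lambda>x. e' x j)"
    unfolding e'_def using asymp_p asymp_e assms(4) asymp_s assms(1,2)
    by (auto intro!: power_asymp_add_or_zero power_asymp_or_zero_divide power_asymp_or_zero_mult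
        simp: power_asymp_or_zero_def)
qed

lemma power_asymp_linear_system:
  fixes p :: "real \<Rightarrow> 'a \<Rightarrow> 'a \<Rightarrow> real" and e H :: "real \<Rightarrow> 'a \<Rightarrow> real"
  assumes "0 < d" "d \<le> 1" "finite T" "i \<in> T"
    and "\<forall>\<^sub>F x in at_right 0. stochastic_reaching T i (p x) \<and>
           (\<forall>j\<in>T. H x j = e x j + (\<Sum>k\<in>T - {i}. p x j k * H x k))"
    and "\<forall>j\<in>T. \<forall>k\<in>T. power_asymp_or_zero d (\<lambda>x. p x j k)"
    and "\<forall>j\<in>T. power_asymp d (\<lambda>x. e x j)"
  shows "power_asymp d (\<lambda>x. H x i)"
  using assms(3-)
proof (induction "card T" arbitrary: T p e rule: less_induct)
  case less
  show ?case
  proof (cases "T = {i}")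
    case True
    from less.prems(3) have "\<forall>\<^sub>F x in at_right 0. e x i = H x i"
      by (rule eventually_mono) (simp add: True)
    with less.prems(5) True show ?thesis
      by (auto intro: power_asymp_cong)
  next
    case False
    then obtain r where r: "r \<in> T" "r \<noteq> i"
      using less.prems(2) by blast
    note step = power_asymp_eliminate_step[OF assms(1,2) less.prems(1) r less.prems(3-5)]
    show ?thesis
      by (rule less.hyps[OF card_Diff1_less[OF less.prems(1) r(1)] _ _ step])
        (use less.prems(1,2) r in auto)
  qed
qed

section \<open>Hitting times as sums over paths\<close>

fun path_weight :: "('a \<Rightarrow> 'a \<Rightarrow> real) \<Rightarrow> 'a list \<Rightarrow> real" where
  "path_weight p (x # y # ys) = p x y * path_weight p (y # ys)"
| "path_weight p _ = 1"

fun path_cost :: "('a \<Rightarrow> 'a \<Rightarrow> real) \<Rightarrow> ('a \<Rightarrow> 'a \<Rightarrow> real) \<Rightarrow> 'a list \<Rightarrow> real" where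
  "path_cost p e (x # y # ys) = e x y * path_weight p (y # ys) + p x y * path_cost p e (y # ys)"
| "path_cost p e _ = 0"

lemma path_weight_eq_prod: "path_weight p ls = (\<Prod>m<length ls - 1. p (ls ! m) (ls ! Suc m))"
  by (induction p ls rule: path_weight.induct) (simp_all add: prod.lessThan_Suc_shift del: prod.lessThan_Suc)

lemma prod_lessThan_Suc_remove_Suc:
  assumes "k < n"
  shows "(\<Prod>m\<in>{..<Suc n} - {Suc k}. g m) = g 0 * (\<Prod>m\<in>{..<n} - {k}. g (Suc m))"
proof -
  have "{..<Suc n} - {Suc k} = insert 0 (Suc ` ({..<n} - {k}))"
    by (auto simp: image_iff less_Suc_eq_0_disj)
  then show ?thesis
    by (simp add: prod.reindex)
qed

lemma prod_lessThan_Suc_remove_0: "(\<Prod>m\<in>{..<Suc n} - {0}. g m) = (\<Prod>m<n. g (Suc m))"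
proof -
  have "{..<Suc n} - {0} = Suc ` {..<n}"
    by (auto simp: image_iff less_Suc_eq_0_disj)
  then show ?thesis
    by (simp add: prod.reindex)
qed

lemma path_cost_eq_sum:
  "path_cost p e ls = (\<Sum>k<length ls - 1. e (ls ! k) (ls ! Suc k) *
      (\<Prod>m\<in>{..<length ls - 1} - {k}. p (ls ! m) (ls ! Suc m)))"
proof (induction p e ls rule: path_cost.induct)
  case (1 p e x y ys)
  define n where "n = length ys"
  define g where "g m = p ((x # y # ys) ! m) ((x # y # ys) ! Suc m)" for m
  have "(\<Sum>k<Suc n. e ((x # y # ys) ! k) ((x # y # ys) ! Suc k) * (\<Prod>m\<in>{..<Suc n} - {k}. g m))
      = e x y * (\<Prod>m\<in>{..<Suc n} - {0}. g m)
        + (\<Sum>k<n. e ((y # ys) ! k) ((y # ys) ! Suc k) * (\<Prod>m\<in>{..<Suc n} - {Suc k}. g m))"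
    by (simp add: sum.lessThan_Suc_shift del: sum.lessThan_Suc)
  also have "(\<Prod>m\<in>{..<Suc n} - {0}. g m) = path_weight p (y # ys)"
    unfolding prod_lessThan_Suc_remove_0 path_weight_eq_prod by (simp add: g_def n_def)
  also have "(\<Sum>k<n. e ((y # ys) ! k) ((y # ys) ! Suc k) * (\<Prod>m\<in>{..<Suc n} - {Suc k}. g m))
      = (\<Sum>k<n. e ((y # ys) ! k) ((y # ys) ! Suc k) * (g 0 * (\<Prod>m\<in>{..<n} - {k}. g (Suc m))))"
    by (intro sum.cong refl) (simp add: prod_lessThan_Suc_remove_Suc)
  also have "\<dots> = p x y * path_cost p e (y # ys)"
    unfolding "1" by (simp add: g_def n_def sum_distrib_left algebra_simps)
  finally show ?case
    by (simp add: g_def n_def)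
qed simp_all

lemma path_time_eq_path_cost: "path_time Q eps ls = path_cost (smp Q eps) (sme Q eps) ls"
  unfolding path_time_def path_cost_eq_sum ..

lemma lists_length_0: "{xs. set xs \<subseteq> S \<and> length xs = 0} = {[]}"
  by auto

lemma sum_lists_length_Suc:
  assumes "finite S"
  shows "(\<Sum>xs\<in>{xs. set xs \<subseteq> S \<and> length xs = Suc n}. f xs)
       = (\<Sum>r\<in>S. \<Sum>xs\<in>{xs. set xs \<subseteq> S \<and> length xs = n}. f (r # xs))"
proof -
  have "inj_on (\<lambda>(xs, r). r # xs) ({xs. set xs \<subseteq> S \<and> length xs = n} \<times> S)"
    by (auto simp: inj_on_def)
  have "(\<Sum>xs\<in>{xs. set xs \<subseteq> S \<and> length xs = Suc n}. f xs)
      = (\<Sum>xs\<in>{xs. set xs \<subseteq> S \<and> length xs = n}. \<Sum>r\<in>S. f (r # xs))"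
    unfolding lists_length_Suc_eq sum.reindex[OF \<open>inj_on _ _\<close>]
    by (simp add: sum.cartesian_product comp_def split_def)
  also have "\<dots> = (\<Sum>r\<in>S. \<Sum>xs\<in>{xs. set xs \<subseteq> S \<and> length xs = n}. f (r # xs))"
    by (rule sum.swap)
  finally show ?thesis .
qed

definition hitting_time :: "'a set \<Rightarrow> ('a \<Rightarrow> 'a \<Rightarrow> real) \<Rightarrow> ('a \<Rightarrow> 'a \<Rightarrow> real) \<Rightarrow> 'a \<Rightarrow> 'a \<Rightarrow> real"
  where "hitting_time X p e i j =
    (\<Sum>n. \<Sum>xs\<in>{xs. set xs \<subseteq> X - {i} \<and> length xs = n}. path_cost p e (j # xs @ [i]))"

lemma sm_return_time_eq_hitting_time:
  "sm_return_time N Q eps i = hitting_time {1..N} (smp Q eps) (sme Q eps) i i"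
  unfolding sm_return_time_def hitting_time_def path_time_eq_path_cost ..

lemma block_decay_imp_geometric:
  fixes u :: "nat \<Rightarrow> real"
  assumes "0 < q" "q < 1" "0 < N" "\<And>m n. m \<le> n \<Longrightarrow> u n \<le> u m" "\<And>a. u (a * N) \<le> q ^ a"
  shows "u n \<le> (1 / q) * root N q ^ n"
proof -
  define \<rho> where "\<rho> = root N q"
  have \<rho>: "0 < \<rho>" "\<rho> < 1" "\<rho> ^ N = q"
    using assms(1-3) by (auto simp: \<rho>_def real_root_lt_1_iff real_root_pow_pos)
  have "u n \<le> u (n div N * N)"
    by (intro assms(4)) simp
  also have "\<dots> \<le> q ^ (n div N)"
    by (rule assms(5))
  also have "\<dots> = (1 / q) * (q ^ (n div N) * \<rho> ^ N)"
    using assms(1) \<rho> by simp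
  also have "\<dots> \<le> (1 / q) * (q ^ (n div N) * \<rho> ^ (n mod N))"
    using assms(1,3) \<rho> by (intro mult_left_mono power_decreasing) auto
  also have "q ^ (n div N) * \<rho> ^ (n mod N) = \<rho> ^ (N * (n div N) + n mod N)"
    by (simp only: power_add power_mult \<rho>(3))
  also have "N * (n div N) + n mod N = n"
    by simp
  finally show ?thesis
    unfolding \<rho>_def .
qed

locale hitting_chain =
  fixes X :: "'a set" and i :: 'a and p e :: "'a \<Rightarrow> 'a \<Rightarrow> real"
  assumes finite_X: "finite X" and i_in_X: "i \<in> X"
    and p_nonneg: "\<And>j k. j \<in> X \<Longrightarrow> k \<in> X \<Longrightarrow> 0 \<le> p j k"
    and p_row_sum: "\<And>j. j \<in> X \<Longrightarrow> (\<Sum>k\<in>X. p j k) = 1"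
    and e_nonneg: "\<And>j k. j \<in> X \<Longrightarrow> k \<in> X \<Longrightarrow> 0 \<le> e j k"
    and e_vanishes: "\<And>j k. j \<in> X \<Longrightarrow> k \<in> X \<Longrightarrow> p j k = 0 \<Longrightarrow> e j k = 0"
    and reaches: "\<And>j. j \<in> X \<Longrightarrow> (j, i) \<in> {(a, b). a \<in> X \<and> b \<in> X \<and> 0 < p a b}\<^sup>+"
begin

text \<open>\<open>avoid_prob n j\<close> is the probability that the chain started in \<open>j\<close> stays outside \<open>i\<close>
  during the steps \<open>1, ..., n\<close>; \<open>first_hit_prob n j\<close> and \<open>first_hit_cost n j\<close> are the
  contributions of the paths that enter \<open>i\<close> for the first time at step \<open>n + 1\<close>.\<close>

fun avoid_prob :: "nat \<Rightarrow> 'a \<Rightarrow> real" where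
  "avoid_prob 0 j = 1"
| "avoid_prob (Suc n) j = (\<Sum>r\<in>X - {i}. p j r * avoid_prob n r)"

definition first_hit_prob :: "nat \<Rightarrow> 'a \<Rightarrow> real" where
  "first_hit_prob n j =
     (\<Sum>xs\<in>{xs. set xs \<subseteq> X - {i} \<and> length xs = n}. path_weight p (j # xs @ [i]))"

definition first_hit_cost :: "nat \<Rightarrow> 'a \<Rightarrow> real" where
  "first_hit_cost n j =
     (\<Sum>xs\<in>{xs. set xs \<subseteq> X - {i} \<and> length xs = n}. path_cost p e (j # xs @ [i]))"

lemma first_hit_prob_0: "first_hit_prob 0 j = p j i"
  unfolding first_hit_prob_def lists_length_0 by simp

lemma first_hit_prob_Suc: "first_hit_prob (Suc n) j = (\<Sum>r\<in>X - {i}. p j r * first_hit_prob n r)"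
  using finite_X
  by (simp add: first_hit_prob_def sum_lists_length_Suc sum_distrib_left)

lemma first_hit_cost_0: "first_hit_cost 0 j = e j i"
  unfolding first_hit_cost_def lists_length_0 by simp

lemma first_hit_cost_Suc:
  "first_hit_cost (Suc n) j = (\<Sum>r\<in>X - {i}. e j r * first_hit_prob n r + p j r * first_hit_cost n r)"
  using finite_X
  by (simp add: first_hit_cost_def first_hit_prob_def sum_lists_length_Suc sum_distrib_left sum.distrib)

lemma sum_p_avoiding: "j \<in> X \<Longrightarrow> (\<Sum>r\<in>X - {i}. p j r) = 1 - p j i"
  using p_row_sum[of j] sum.remove[OF finite_X i_in_X, of "p j"] by simp

lemma avoid_prob_nonneg: "j \<in> X \<Longrightarrow> 0 \<le> avoid_prob n j"
  by (induction n arbitrary: j) (auto intro!: sum_nonneg simp: p_nonneg)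

lemma avoid_prob_Suc_le: "j \<in> X \<Longrightarrow> avoid_prob (Suc n) j \<le> 1 - p j i"
proof (induction n arbitrary: j)
  case 0
  then show ?case by (simp add: sum_p_avoiding)
next
  case (Suc n)
  have "avoid_prob (Suc (Suc n)) j = (\<Sum>r\<in>X - {i}. p j r * avoid_prob (Suc n) r)"
    by (rule avoid_prob.simps(2))
  also have "\<dots> \<le> (\<Sum>r\<in>X - {i}. p j r * 1)"
  proof (intro sum_mono mult_left_mono)
    fix r assume r: "r \<in> X - {i}"
    then show "avoid_prob (Suc n) r \<le> 1"
      using Suc.IH[of r] p_nonneg[OF _ i_in_X, of r] by simp
    show "0 \<le> p j r" using Suc.prems r by (simp add: p_nonneg)
  qed
  finally show ?case using Suc.prems by (simp add: sum_p_avoiding)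
qed

lemma avoid_prob_le_1: "j \<in> X \<Longrightarrow> avoid_prob n j \<le> 1"
proof (cases n)
  case (Suc m)
  assume "j \<in> X"
  then show ?thesis
    using Suc avoid_prob_Suc_le[of j m] p_nonneg[OF _ i_in_X, of j] by simp
qed simp

lemma first_hit_prob_eq_diff: "j \<in> X \<Longrightarrow> first_hit_prob n j = avoid_prob n j - avoid_prob (Suc n) j"
proof (induction n arbitrary: j)
  case 0
  then show ?case by (simp add: first_hit_prob_0 sum_p_avoiding)
next
  case (Suc n)
  have "first_hit_prob (Suc n) j = (\<Sum>r\<in>X - {i}. p j r * (avoid_prob n r - avoid_prob (Suc n) r))"
    unfolding first_hit_prob_Suc using Suc.IH by (intro sum.cong refl) auto
  also have "\<dots> = avoid_prob (Suc n) j - avoid_prob (Suc (Suc n)) j"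
    by (simp only: avoid_prob.simps(2) right_diff_distrib sum_subtractf)
  finally show ?case .
qed

lemma first_hit_prob_nonneg: "j \<in> X \<Longrightarrow> 0 \<le> first_hit_prob n j"
  by (induction n arbitrary: j) (auto intro!: sum_nonneg simp: first_hit_prob_0 first_hit_prob_Suc p_nonneg i_in_X)

lemma avoid_prob_antimono: "j \<in> X \<Longrightarrow> m \<le> n \<Longrightarrow> avoid_prob n j \<le> avoid_prob m j"
  using lift_Suc_antimono_le[of "\<lambda>n. avoid_prob n j"] first_hit_prob_eq_diff first_hit_prob_nonneg
  by fastforce

lemma first_hit_prob_le_avoid_prob: "j \<in> X \<Longrightarrow> first_hit_prob n j \<le> avoid_prob n j"
  using first_hit_prob_eq_diff[of j n] avoid_prob_nonneg[of j "Suc n"] by simp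

lemma first_hit_cost_nonneg: "j \<in> X \<Longrightarrow> 0 \<le> first_hit_cost n j"
  by (induction n arbitrary: j)
    (auto intro!: sum_nonneg simp: first_hit_cost_0 first_hit_cost_Suc p_nonneg e_nonneg i_in_X
      first_hit_prob_nonneg)

lemma first_hit_cost_le:
  assumes "\<And>j k. j \<in> X \<Longrightarrow> k \<in> X \<Longrightarrow> e j k \<le> M * p j k" "0 \<le> M"
  shows "j \<in> X \<Longrightarrow> first_hit_cost n j \<le> M * (real n + 1) * avoid_prob n j"
proof (induction n arbitrary: j)
  case 0
  have "e j i \<le> M * first_hit_prob 0 j"
    using assms(1)[OF 0 i_in_X] by (simp add: first_hit_prob_0)
  also have "\<dots> \<le> M * avoid_prob 0 j"
    using first_hit_prob_le_avoid_prob[OF 0] assms(2) by (rule mult_left_mono)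
  finally show ?case
    by (simp add: first_hit_cost_0)
next
  case (Suc n)
  have "first_hit_cost (Suc n) j
      \<le> (\<Sum>r\<in>X - {i}. M * p j r * avoid_prob n r + p j r * (M * (real n + 1) * avoid_prob n r))"
    unfolding first_hit_cost_Suc
  proof (intro sum_mono add_mono)
    fix r assume "r \<in> X - {i}"
    then have r: "r \<in> X" by simp
    show "e j r * first_hit_prob n r \<le> M * p j r * avoid_prob n r"
      using assms(1)[OF Suc.prems r] first_hit_prob_le_avoid_prob[OF r] first_hit_prob_nonneg[OF r]
        e_nonneg[OF Suc.prems r] assms(2) p_nonneg[OF Suc.prems r]
      by (intro mult_mono) auto
    show "p j r * first_hit_cost n r \<le> p j r * (M * (real n + 1) * avoid_prob n r)"
      using Suc.IH[OF r] p_nonneg[OF Suc.prems r] by (rule mult_left_mono)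
  qed
  also have "\<dots> = M * (real (Suc n) + 1) * avoid_prob (Suc n) j"
    by (simp add: sum_distrib_left algebra_simps)
  finally show ?case .
qed

lemma avoid_prob_Suc_lt_1:
  assumes "j \<in> X" "r \<in> X" "0 < p j r" "r = i \<or> avoid_prob n r < 1"
  shows "avoid_prob (Suc n) j < 1"
proof (cases "r = i")
  case True
  then show ?thesis
    using avoid_prob_Suc_le[OF assms(1), of n] assms(3) by simp
next
  case False
  then have "avoid_prob n r < 1"
    using assms(4) by simp
  have "avoid_prob (Suc n) j < (\<Sum>r\<in>X - {i}. p j r * 1)"
    unfolding avoid_prob.simps(2)
  proof (rule sum_strict_mono_ex1)
    show "\<forall>r\<in>X - {i}. p j r * avoid_prob n r \<le> p j r * 1"
    proof
      fix r assume "r \<in> X - {i}"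
      then show "p j r * avoid_prob n r \<le> p j r * 1"
        using assms(1) by (intro mult_left_mono avoid_prob_le_1 p_nonneg) auto
    qed
    show "\<exists>r\<in>X - {i}. p j r * avoid_prob n r < p j r * 1"
      using assms(2,3) False \<open>avoid_prob n r < 1\<close> by (intro bexI[of _ r]) auto
  qed (use finite_X in simp)
  also have "\<dots> \<le> 1"
    using assms(1) sum_p_avoiding p_nonneg[OF _ i_in_X] by simp
  finally show ?thesis .
qed

lemma avoid_prob_lt_1:
  assumes "j \<in> X"
  shows "\<exists>n. avoid_prob n j < 1"
  using reaches[OF assms]
proof (induction rule: converse_trancl_induct)
  case (base j)
  then show ?case
    using avoid_prob_Suc_lt_1[of j i 0] by blast
next
  case (step j r)
  then obtain n where "avoid_prob n r < 1" by blast
  then show ?case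
    using step.hyps(1) avoid_prob_Suc_lt_1[of j r n] by blast
qed

lemma avoid_prob_mult_le:
  assumes "\<And>r. r \<in> X \<Longrightarrow> avoid_prob m r \<le> B" "0 \<le> B"
  shows "j \<in> X \<Longrightarrow> avoid_prob (n + m) j \<le> B * avoid_prob n j"
proof (induction n arbitrary: j)
  case 0
  then show ?case using assms(1) by simp
next
  case (Suc n)
  have "avoid_prob (Suc n + m) j = (\<Sum>r\<in>X - {i}. p j r * avoid_prob (n + m) r)"
    by simp
  also have "\<dots> \<le> (\<Sum>r\<in>X - {i}. p j r * (B * avoid_prob n r))"
    using Suc p_nonneg by (intro sum_mono mult_left_mono) auto
  also have "\<dots> = B * avoid_prob (Suc n) j"
    by (simp add: sum_distrib_left algebra_simps)
  finally show ?case .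
qed

lemma avoid_prob_uniformly_lt_1: "\<exists>N. \<forall>j\<in>X. avoid_prob N j < 1"
proof -
  have "\<forall>j\<in>X. \<exists>n. avoid_prob n j < 1"
    using avoid_prob_lt_1 by blast
  then obtain n where n: "\<forall>j\<in>X. avoid_prob (n j) j < 1"
    by (auto dest!: bchoice)
  have "avoid_prob (Max (n ` X)) j < 1" if "j \<in> X" for j
    using avoid_prob_antimono[OF that, of "n j" "Max (n ` X)"] n that finite_X by fastforce
  then show ?thesis by blast
qed

lemma avoid_prob_block_decay: "\<exists>N q. 0 < N \<and> 0 < q \<and> q < 1 \<and> (\<forall>j\<in>X. \<forall>a. avoid_prob (a * N) j \<le> q ^ a)"
proof -
  obtain N where N: "\<forall>j\<in>X. avoid_prob N j < 1"
    using avoid_prob_uniformly_lt_1 by blast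
  then have "N > 0"
    using i_in_X by (cases N) auto
  define q where "q = max (1 / 2) (Max ((\<lambda>j. avoid_prob N j) ` X))"
  have "Max ((\<lambda>j. avoid_prob N j) ` X) < 1"
    using N finite_X i_in_X by (subst Max_less_iff) auto
  then have q: "0 < q" "q < 1"
    by (auto simp: q_def)
  have bound_N: "\<forall>j\<in>X. avoid_prob N j \<le> q"
    using finite_X unfolding q_def by (auto intro: max.coboundedI2)
  have "avoid_prob (a * N) j \<le> q ^ a" if "j \<in> X" for a j
    using that
  proof (induction a arbitrary: j)
    case (Suc a)
    have "avoid_prob (a * N + N) j \<le> q * avoid_prob (a * N) j"
      using avoid_prob_mult_le[of N q j "a * N"] bound_N Suc.prems q by auto
    also have "\<dots> \<le> q * q ^ a"
      using Suc q by (intro mult_left_mono) auto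
    finally show ?case by (simp add: add.commute)
  qed simp
  with \<open>N > 0\<close> q show ?thesis by blast
qed

lemma avoid_prob_geometric: "\<exists>\<rho> C. 0 \<le> \<rho> \<and> \<rho> < 1 \<and> (\<forall>j\<in>X. \<forall>n. avoid_prob n j \<le> C * \<rho> ^ n)"
proof -
  obtain N q where "0 < N" "0 < q" "q < 1" and block: "\<forall>j\<in>X. \<forall>a. avoid_prob (a * N) j \<le> q ^ a"
    using avoid_prob_block_decay by blast
  have "avoid_prob n j \<le> (1 / q) * root N q ^ n" if "j \<in> X" for j n
    using \<open>0 < q\<close> \<open>q < 1\<close> \<open>0 < N\<close> avoid_prob_antimono[OF that] block that
    by (intro block_decay_imp_geometric) auto
  moreover have "0 \<le> root N q" "root N q < 1"
    using \<open>0 < q\<close> \<open>q < 1\<close> \<open>0 < N\<close> by (auto simp: real_root_lt_1_iff)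
  ultimately show ?thesis by blast
qed

lemma e_le_const_mult_p: "\<exists>M\<ge>0. \<forall>j\<in>X. \<forall>k\<in>X. e j k \<le> M * p j k"
proof (intro exI conjI ballI)
  let ?M = "\<Sum>j\<in>X. \<Sum>k\<in>X. e j k / p j k"
  have ratio_nonneg: "0 \<le> e j k / p j k" if "j \<in> X" "k \<in> X" for j k
    using that by (simp add: e_nonneg p_nonneg)
  then show "0 \<le> ?M"
    by (simp add: sum_nonneg)
  fix j k assume jk: "j \<in> X" "k \<in> X"
  show "e j k \<le> ?M * p j k"
  proof (cases "p j k = 0")
    case False
    have "e j k / p j k \<le> (\<Sum>k\<in>X. e j k / p j k)"
      using jk ratio_nonneg finite_X by (intro member_le_sum) auto
    also have "\<dots> \<le> ?M"
      using jk ratio_nonneg finite_X by (intro member_le_sum[of j X] sum_nonneg) auto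
    finally show ?thesis
      using False p_nonneg[OF jk] by (simp add: divide_le_eq)
  qed (simp add: e_vanishes jk)
qed

lemma first_hit_cost_summable: "j \<in> X \<Longrightarrow> summable (\<lambda>n. first_hit_cost n j)"
proof -
  assume j: "j \<in> X"
  obtain \<rho> C where \<rho>: "0 \<le> \<rho>" "\<rho> < 1" and decay: "\<forall>j\<in>X. \<forall>n. avoid_prob n j \<le> C * \<rho> ^ n"
    using avoid_prob_geometric by blast
  obtain M where "0 \<le> M" and M: "\<forall>j\<in>X. \<forall>k\<in>X. e j k \<le> M * p j k"
    using e_le_const_mult_p by blast
  have "summable (\<lambda>n. M * C * (real (Suc n) * \<rho> ^ n))"
    using geometric_deriv_sums[of \<rho>] \<rho> by (intro summable_mult sums_summable) auto
  moreover have "norm (first_hit_cost n j) \<le> M * C * (real (Suc n) * \<rho> ^ n)" for n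
  proof -
    have "norm (first_hit_cost n j) \<le> M * (real n + 1) * avoid_prob n j"
      using first_hit_cost_nonneg[OF j] first_hit_cost_le[OF _ \<open>0 \<le> M\<close> j] M by simp
    also have "\<dots> \<le> M * (real n + 1) * (C * \<rho> ^ n)"
      using decay j \<open>0 \<le> M\<close> by (intro mult_left_mono) auto
    finally show ?thesis by (simp add: algebra_simps)
  qed
  ultimately show ?thesis
    by (rule summable_comparison_test'[where N = 0])
qed

lemma first_hit_prob_sums: "j \<in> X \<Longrightarrow> (\<lambda>n. first_hit_prob n j) sums 1"
proof -
  assume j: "j \<in> X"
  obtain \<rho> C where \<rho>: "0 \<le> \<rho>" "\<rho> < 1" and decay: "\<forall>j\<in>X. \<forall>n. avoid_prob n j \<le> C * \<rho> ^ n"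
    using avoid_prob_geometric by blast
  have "\<forall>\<^sub>F n in sequentially. 0 \<le> avoid_prob n j"
    using avoid_prob_nonneg[OF j] by simp
  moreover have "\<forall>\<^sub>F n in sequentially. avoid_prob n j \<le> C * \<rho> ^ n"
    using decay j by simp
  moreover have "(\<lambda>n. C * \<rho> ^ n) \<longlonglongrightarrow> 0"
    using tendsto_mult_left[OF LIMSEQ_realpow_zero[OF \<rho>], of C] by simp
  ultimately have "(\<lambda>n. avoid_prob n j) \<longlonglongrightarrow> 0"
    by (rule tendsto_sandwich[OF _ _ tendsto_const])
  then have "(\<lambda>n. avoid_prob n j - avoid_prob (Suc n) j) sums (avoid_prob 0 j - 0)"
    by (rule telescope_sums')
  then show ?thesis
    using first_hit_prob_eq_diff[OF j] by simp
qed

lemma hitting_time_eq: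
  assumes "j \<in> X"
  shows "hitting_time X p e i j = (\<Sum>k\<in>X. e j k) + (\<Sum>r\<in>X - {i}. p j r * hitting_time X p e i r)"
proof -
  have H: "hitting_time X p e i r = (\<Sum>n. first_hit_cost n r)" for r
    unfolding hitting_time_def first_hit_cost_def ..
  have cost: "summable (\<lambda>n. first_hit_cost n r)" and prob: "(\<lambda>n. first_hit_prob n r) sums 1"
    if "r \<in> X - {i}" for r
    using that first_hit_cost_summable first_hit_prob_sums by auto
  have "(\<lambda>n. \<Sum>r\<in>X - {i}. e j r * first_hit_prob n r + p j r * first_hit_cost n r)
      sums (\<Sum>r\<in>X - {i}. e j r * 1 + p j r * hitting_time X p e i r)"
    unfolding H using cost prob
    by (intro sums_sum sums_add sums_mult summable_sums) auto
  then have "(\<lambda>n. first_hit_cost (Suc n) j) sums (\<Sum>r\<in>X - {i}. e j r + p j r * hitting_time X p e i r)"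
    by (simp add: first_hit_cost_Suc)
  then have "(\<lambda>n. first_hit_cost n j)
      sums ((\<Sum>r\<in>X - {i}. e j r + p j r * hitting_time X p e i r) + first_hit_cost 0 j)"
    by (rule sums_Suc)
  moreover have "(\<Sum>r\<in>X - {i}. e j r + p j r * hitting_time X p e i r) + first_hit_cost 0 j
      = (\<Sum>k\<in>X. e j k) + (\<Sum>r\<in>X - {i}. p j r * hitting_time X p e i r)"
    using sum.remove[OF finite_X i_in_X, of "e j"] by (simp add: first_hit_cost_0 sum.distrib)
  ultimately show ?thesis
    unfolding H by (simp add: sums_iff)
qed

lemma hitting_time_nonneg: "j \<in> X \<Longrightarrow> 0 \<le> hitting_time X p e i j"
  unfolding hitting_time_def first_hit_cost_def[symmetric]
  by (intro suminf_nonneg first_hit_cost_summable first_hit_cost_nonneg)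

lemma sum_e_le_hitting_time: "(\<Sum>k\<in>X. e i k) \<le> hitting_time X p e i i"
proof -
  have "0 \<le> (\<Sum>r\<in>X - {i}. p i r * hitting_time X p e i r)"
    using i_in_X by (intro sum_nonneg mult_nonneg_nonneg p_nonneg hitting_time_nonneg) auto
  then show ?thesis
    using hitting_time_eq[OF i_in_X] by linarith
qed

lemma stochastic_reaching: "stochastic_reaching X i p"
  unfolding stochastic_reaching_def
proof (intro conjI ballI allI impI)
  fix U assume U: "U \<subseteq> X - {i}" "U \<noteq> {}"
  then obtain j where "j \<in> U" by blast
  have "\<exists>a\<in>U. \<exists>c\<in>X - U. 0 < p a c"
    if "(j, b) \<in> {(a, b). a \<in> X \<and> b \<in> X \<and> 0 < p a b}\<^sup>+" "b \<notin> U" for b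
    using that
  proof (induction rule: trancl_induct)
    case (step c b)
    then show ?case by (cases "c \<in> U") auto
  qed (use \<open>j \<in> U\<close> in auto)
  then show "\<exists>j\<in>U. \<exists>k\<in>X - U. 0 < p j k"
    using reaches[of j] \<open>j \<in> U\<close> U by blast
qed (auto simp: p_nonneg p_row_sum)


lemma hitting_time_system:
  "stochastic_reaching X i p \<and>
   (\<forall>j\<in>X. hitting_time X p e i j = (\<Sum>k\<in>X. e j k) + (\<Sum>k\<in>X - {i}. p j k * hitting_time X p e i k))"
  using stochastic_reaching hitting_time_eq by blast

lemma sojourn_div_hitting_time_le_1: "(\<Sum>k\<in>X. e i k) / hitting_time X p e i i \<le> 1"
proof -
  have "0 \<le> (\<Sum>k\<in>X. e i k)"
    using i_in_X by (intro sum_nonneg e_nonneg)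
  then show ?thesis
    using sum_e_le_hitting_time
    by (cases "hitting_time X p e i i = 0") (simp_all add: divide_le_eq_1)
qed
end

section \<open>Perturbed semi-Markov kernels\<close>

lemma integral_ident_nonneg:
  fixes M :: "real measure"
  assumes "sets M = sets borel" "emeasure M {..<0} = 0"
  shows "0 \<le> (\<integral>t. t \<partial>M)"
proof -
  have "{..<0} \<in> null_sets M"
    using assms by (simp add: null_sets_def)
  then have "AE t in M. 0 \<le> t"
    by (rule AE_I') auto
  then show ?thesis
    by (rule integral_nonneg_AE)
qed

lemma integral_eq_0_if_measure_UNIV_0:
  fixes M :: "real measure"
  assumes "finite_measure M" "sets M = sets borel" "measure M UNIV = 0"
  shows "integral\<^sup>L M f = 0"
proof -
  have "space M = UNIV"
    using sets_eq_imp_space_eq[OF assms(2)] by simp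
  then have "emeasure M (space M) = 0"
    using assms(1,3) by (simp add: finite_measure.emeasure_eq_measure)
  then have "space M \<in> null_sets M"
    by (simp add: null_sets_def)
  then have "AE t in M. f t = 0"
    by (rule AE_I') auto
  then show ?thesis
    by (rule integral_eq_zero_AE)
qed

lemma support_path_imp_trancl:
  fixes l :: "nat \<Rightarrow> 'a" and n :: nat
  assumes "\<forall>a\<in>X. Y a \<subseteq> X" "\<forall>a\<in>X. \<forall>b\<in>Y a. 0 < p a b"
    and "1 \<le> n" "l 0 \<in> X" "\<forall>m\<in>{1..n}. l m \<in> Y (l (m - 1))"
  shows "(l 0, l n) \<in> {(a, b). a \<in> X \<and> b \<in> X \<and> 0 < p a b}\<^sup>+"
proof -
  have step: "l (Suc m) \<in> Y (l m)" if "m < n" for m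
  proof -
    have "Suc m \<in> {1..n}"
      using that by simp
    then show ?thesis
      using assms(5) by fastforce
  qed
  have X: "l m \<in> X" if "m \<le> n" for m
    using that
  proof (induction m)
    case (Suc m)
    then show ?case
      using assms(1) step[of m] by auto
  qed (use assms(4) in simp)
  have "\<forall>m<n. (l m, l (Suc m)) \<in> {(a, b). a \<in> X \<and> b \<in> X \<and> 0 < p a b}"
    using X step assms(2) by auto
  then have "(l 0, l n) \<in> {(a, b). a \<in> X \<and> b \<in> X \<and> 0 < p a b} ^^ n"
    unfolding relpow_fun_conv by blast
  then show ?thesis
    unfolding trancl_power using assms(3) by (intro exI[of _ n]) auto
qed

lemma eventually_hitting_chain_smp:
  fixes Q :: smkernel
  assumes "finite X" "i \<in> X" "0 < eps0"
    and "\<And>eps j k. 0 < eps \<Longrightarrow> eps \<le> eps0 \<Longrightarrow> j \<in> X \<Longrightarrow> k \<in> X \<Longrightarrow> sets (Q eps j k) = sets borel"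
    and "\<And>eps j k. 0 < eps \<Longrightarrow> eps \<le> eps0 \<Longrightarrow> j \<in> X \<Longrightarrow> k \<in> X \<Longrightarrow> finite_measure (Q eps j k)"
    and "\<And>eps j k. 0 < eps \<Longrightarrow> eps \<le> eps0 \<Longrightarrow> j \<in> X \<Longrightarrow> k \<in> X \<Longrightarrow> emeasure (Q eps j k) {..<0} = 0"
    and "\<And>eps j. 0 < eps \<Longrightarrow> eps \<le> eps0 \<Longrightarrow> j \<in> X \<Longrightarrow> (\<Sum>k\<in>X. smp Q eps j k) = 1"
    and "\<And>j. j \<in> X \<Longrightarrow> Y j \<subseteq> X \<and> Y j \<noteq> {}"
    and "\<And>eps j k. 0 < eps \<Longrightarrow> eps \<le> eps0 \<Longrightarrow> j \<in> X \<Longrightarrow> k \<in> Y j \<Longrightarrow> smp Q eps j k > 0"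
    and "\<And>eps j k. 0 < eps \<Longrightarrow> eps \<le> eps0 \<Longrightarrow> j \<in> X \<Longrightarrow> k \<in> X \<Longrightarrow> k \<notin> Y j \<Longrightarrow> smp Q eps j k = 0"
    and "\<And>j. j \<in> X \<Longrightarrow>
      \<exists>n\<ge>1. \<exists>l :: nat \<Rightarrow> nat. l 0 = j \<and> l n = i \<and> (\<forall>m\<in>{1..n}. l m \<in> Y (l (m - 1)))"
  shows "\<forall>\<^sub>F eps in at_right 0.
    hitting_chain X i (smp Q eps) (sme Q eps) \<and> (\<forall>j\<in>X. \<forall>k\<in>X - Y j. smp Q eps j k = 0)"
proof (rule eventually_at_right_0I[OF assms(3)], intro allI impI conjI)
  fix eps assume eps: "0 < eps \<and> eps \<le> eps0"
  show "hitting_chain X i (smp Q eps) (sme Q eps)"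
  proof
    fix j k assume "j \<in> X" "k \<in> X"
    then show "0 \<le> smp Q eps j k" "0 \<le> sme Q eps j k"
      "smp Q eps j k = 0 \<Longrightarrow> sme Q eps j k = 0"
      using assms(4-6) eps unfolding smp_def sme_def
      by (auto intro: integral_ident_nonneg integral_eq_0_if_measure_UNIV_0)
  next
    fix j assume "j \<in> X"
    then obtain n and l :: "nat \<Rightarrow> nat"
      where "1 \<le> n" "l 0 = j" "l n = i" "\<forall>m\<in>{1..n}. l m \<in> Y (l (m - 1))"
      using assms(11) by blast
    then show "(j, i) \<in> {(a, b). a \<in> X \<and> b \<in> X \<and> 0 < smp Q eps a b}\<^sup>+"
      using support_path_imp_trancl[of X Y "smp Q eps" n l] assms(8,9) eps \<open>j \<in> X\<close> by auto
  qed (use assms(1,2,7) eps in auto)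
  show "\<forall>j\<in>X. \<forall>k\<in>X - Y j. smp Q eps j k = 0"
    using assms(10) eps by blast
qed

lemma min_exponent_bounds:
  fixes dl dld :: "'a \<Rightarrow> 'a \<Rightarrow> real"
  assumes "finite X" "X \<noteq> {}" "\<And>a. a \<in> X \<Longrightarrow> Y a \<subseteq> X \<and> Y a \<noteq> {}"
    and "\<And>a b. a \<in> X \<Longrightarrow> b \<in> Y a \<Longrightarrow> 0 < dl a b \<and> dl a b \<le> 1 \<and> 0 < dld a b"
  defines "\<delta> \<equiv> Min {min (dl a b) (dld a b) | a b. a \<in> X \<and> b \<in> Y a}"
  shows "0 < \<delta>" "\<delta> \<le> 1" "a \<in> X \<Longrightarrow> b \<in> Y a \<Longrightarrow> \<delta> \<le> dl a b \<and> \<delta> \<le> dld a b"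
proof -
  let ?D = "{min (dl a b) (dld a b) | a b. a \<in> X \<and> b \<in> Y a}"
  have "?D = (\<lambda>(a, b). min (dl a b) (dld a b)) ` (SIGMA a:X. Y a)"
    by auto
  moreover have "finite (SIGMA a:X. Y a)"
    using assms(1,3) by (blast intro: finite_SigmaI finite_subset)
  ultimately have fin: "finite ?D"
    by simp
  moreover have "?D \<noteq> {}"
    using assms(2,3) by fastforce
  ultimately have "\<delta> \<in> ?D"
    unfolding \<delta>_def by (rule Min_in)
  then show "0 < \<delta>" "\<delta> \<le> 1"
    using assms(4) by force+
  show "a \<in> X \<Longrightarrow> b \<in> Y a \<Longrightarrow> \<delta> \<le> dl a b \<and> \<delta> \<le> dld a b"
    unfolding \<delta>_def using Min_le[OF fin, of "min (dl a b) (dld a b)"] by auto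
qed

lemma power_asymp_transitions:
  fixes p e :: "real \<Rightarrow> 'a \<Rightarrow> 'a \<Rightarrow> real"
  assumes "0 < d" "d \<le> 1" "finite X"
    and chain: "\<forall>\<^sub>F x in at_right 0. hitting_chain X i (p x) (e x) \<and> (\<forall>j\<in>X. \<forall>k\<in>X - Y j. p x j k = 0)"
    and Y: "\<And>j. j \<in> X \<Longrightarrow> Y j \<subseteq> X \<and> Y j \<noteq> {}"
    and asymp: "\<And>j k. j \<in> X \<Longrightarrow> k \<in> Y j \<Longrightarrow> power_asymp d (\<lambda>x. p x j k) \<and> power_asymp d (\<lambda>x. e x j k)"
  shows "\<forall>j\<in>X. \<forall>k\<in>X. power_asymp_or_zero d (\<lambda>x. p x j k)"
    and "\<forall>j\<in>X. power_asymp d (\<lambda>x. \<Sum>k\<in>X. e x j k)"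
proof -
  have vanish: "\<forall>\<^sub>F x in at_right 0. p x j k = 0 \<and> e x j k = 0" if "j \<in> X" "k \<in> X - Y j" for j k
    using chain by (rule eventually_mono) (use that in \<open>auto dest: hitting_chain.e_vanishes\<close>)
  have asymp_or_zero: "power_asymp_or_zero d (\<lambda>x. p x j k) \<and> power_asymp_or_zero d (\<lambda>x. e x j k)"
    if "j \<in> X" "k \<in> X" for j k
    using asymp[of j k] vanish[of j k] that
    by (cases "k \<in> Y j") (auto simp: power_asymp_or_zero_def eventually_conj_iff)
  then show "\<forall>j\<in>X. \<forall>k\<in>X. power_asymp_or_zero d (\<lambda>x. p x j k)"
    by blast
  show "\<forall>j\<in>X. power_asymp d (\<lambda>x. \<Sum>k\<in>X. e x j k)"
  proof
    fix j assume "j \<in> X"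
    then obtain k where "k \<in> Y j" "k \<in> X"
      using Y by blast
    then show "power_asymp d (\<lambda>x. \<Sum>k\<in>X. e x j k)"
      using assms(1-3) asymp asymp_or_zero \<open>j \<in> X\<close> by (intro power_asymp_sum) auto
  qed
qed

lemma power_asymp_stationary_prob:
  fixes p e :: "real \<Rightarrow> 'a \<Rightarrow> 'a \<Rightarrow> real"
  assumes "0 < d" "d \<le> 1" "finite X" "i \<in> X"
    and chain: "\<forall>\<^sub>F x in at_right 0. hitting_chain X i (p x) (e x) \<and> (\<forall>j\<in>X. \<forall>k\<in>X - Y j. p x j k = 0)"
    and "\<And>j. j \<in> X \<Longrightarrow> Y j \<subseteq> X \<and> Y j \<noteq> {}"
    and "\<And>j k. j \<in> X \<Longrightarrow> k \<in> Y j \<Longrightarrow> power_asymp d (\<lambda>x. p x j k) \<and> power_asymp d (\<lambda>x. e x j k)"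
  shows "power_asymp d (\<lambda>x. (\<Sum>k\<in>X. e x i k) / hitting_time X (p x) (e x) i i)"
    and "\<forall>\<^sub>F x in at_right 0. (\<Sum>k\<in>X. e x i k) / hitting_time X (p x) (e x) i i \<le> 1"
proof -
  note asymp = power_asymp_transitions[OF assms(1-3) chain assms(6,7)]
  have "\<forall>\<^sub>F x in at_right 0. stochastic_reaching X i (p x) \<and>
      (\<forall>j\<in>X. hitting_time X (p x) (e x) i j
         = (\<Sum>k\<in>X. e x j k) + (\<Sum>k\<in>X - {i}. p x j k * hitting_time X (p x) (e x) i k))"
    using chain by (rule eventually_mono) (blast dest: hitting_chain.hitting_time_system)
  from power_asymp_linear_system[OF assms(1-4) this asymp]
  have "power_asymp d (\<lambda>x. (\<Sum>k\<in>X. e x i k) * (1 / hitting_time X (p x) (e x) i i))"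
    using asymp(2) assms(4) by (intro power_asymp_mult[OF assms(1)] power_asymp_inverse[OF assms(1)]) auto
  then show "power_asymp d (\<lambda>x. (\<Sum>k\<in>X. e x i k) / hitting_time X (p x) (e x) i i)"
    by simp
  show "\<forall>\<^sub>F x in at_right 0. (\<Sum>k\<in>X. e x i k) / hitting_time X (p x) (e x) i i \<le> 1"
    using chain by (rule eventually_mono) (simp add: hitting_chain.sojourn_div_hitting_time_le_1)
qed

theorem theorem4:
  fixes N :: nat and eps0 :: real and Q :: smkernel and Y :: "nat \<Rightarrow> nat set"
    and lm lp :: "nat \<Rightarrow> nat \<Rightarrow> nat" and a :: "nat \<Rightarrow> nat \<Rightarrow> nat \<Rightarrow> real"
    and dl G epsp :: "nat \<Rightarrow> nat \<Rightarrow> real"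
    and mm mp :: "nat \<Rightarrow> nat \<Rightarrow> int" and b :: "nat \<Rightarrow> nat \<Rightarrow> int \<Rightarrow> real"
    and dld Gd epsd :: "nat \<Rightarrow> nat \<Rightarrow> real"
  assumes N: "N \<ge> 1"
    and eps0: "0 < eps0" "eps0 \<le> 1"
    \<comment> \<open>standing conditions: semi-Markov kernels with finite expectations\<close>
    and kern_sets: "\<And>eps i j. 0 < eps \<Longrightarrow> eps \<le> eps0 \<Longrightarrow> i \<in> {1..N} \<Longrightarrow> j \<in> {1..N} \<Longrightarrow>
          sets (Q eps i j) = sets borel"
    and kern_fin: "\<And>eps i j. 0 < eps \<Longrightarrow> eps \<le> eps0 \<Longrightarrow> i \<in> {1..N} \<Longrightarrow> j \<in> {1..N} \<Longrightarrow>
          finite_measure (Q eps i j)"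
    and kern_pos: "\<And>eps i j. 0 < eps \<Longrightarrow> eps \<le> eps0 \<Longrightarrow> i \<in> {1..N} \<Longrightarrow> j \<in> {1..N} \<Longrightarrow>
          emeasure (Q eps i j) {..<0} = 0"
    and kern_int: "\<And>eps i j. 0 < eps \<Longrightarrow> eps \<le> eps0 \<Longrightarrow> i \<in> {1..N} \<Longrightarrow> j \<in> {1..N} \<Longrightarrow>
          integrable (Q eps i j) (\<lambda>t. t)"
    and kern_stoch: "\<And>eps i. 0 < eps \<Longrightarrow> eps \<le> eps0 \<Longrightarrow> i \<in> {1..N} \<Longrightarrow>
          (\<Sum>j\<in>{1..N}. smp Q eps i j) = 1"
    \<comment> \<open>Condition A\<close>
    and A_sub: "\<And>i. i \<in> {1..N} \<Longrightarrow> Y i \<subseteq> {1..N} \<and> Y i \<noteq> {}"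
    and A_a: "\<And>eps i j. 0 < eps \<Longrightarrow> eps \<le> eps0 \<Longrightarrow> i \<in> {1..N} \<Longrightarrow> j \<in> Y i \<Longrightarrow>
          smp Q eps i j > 0"
    and A_b: "\<And>eps i j. 0 < eps \<Longrightarrow> eps \<le> eps0 \<Longrightarrow> i \<in> {1..N} \<Longrightarrow> j \<in> {1..N} \<Longrightarrow>
          j \<notin> Y i \<Longrightarrow> smp Q eps i j = 0"
    and A_c: "\<And>i j. i \<in> {1..N} \<Longrightarrow> j \<in> {1..N} \<Longrightarrow>
          \<exists>n\<ge>1. \<exists>l :: nat \<Rightarrow> nat. l 0 = i \<and> l n = j \<and> (\<forall>m\<in>{1..n}. l m \<in> Y (l (m - 1)))"
    \<comment> \<open>Condition D'\<close>
    and D: "\<And>i j. i \<in> {1..N} \<Longrightarrow> j \<in> Y i \<Longrightarrow>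
          lm i j \<le> lp i j \<and> a i j (lm i j) > 0 \<and> 0 < dl i j \<and> dl i j \<le> 1 \<and> 0 < G i j \<and>
          0 < epsp i j \<and> epsp i j \<le> eps0 \<and>
          (\<forall>eps. 0 < eps \<and> eps \<le> epsp i j \<longrightarrow>
             \<bar>smp Q eps i j - (\<Sum>l=lm i j..lp i j. a i j l * eps ^ l)\<bar>
               \<le> G i j * eps powr (real (lp i j) + dl i j))"
    \<comment> \<open>Condition E'\<close>
    and E: "\<And>i j. i \<in> {1..N} \<Longrightarrow> j \<in> Y i \<Longrightarrow>
          mm i j \<le> mp i j \<and> b i j (mm i j) > 0 \<and> 0 < dld i j \<and> dld i j \<le> 1 \<and> 0 < Gd i j \<and>
          0 < epsd i j \<and> epsd i j \<le> eps0 \<and>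
          (\<forall>eps. 0 < eps \<and> eps \<le> epsd i j \<longrightarrow>
             \<bar>sme Q eps i j - (\<Sum>l=mm i j..mp i j. b i j l * eps powi l)\<bar>
               \<le> Gd i j * eps powr (real_of_int (mp i j) + dld i j))"
  shows "\<forall>i\<in>{1..N}. \<exists>nm np :: nat. \<exists>c :: nat \<Rightarrow> real. \<exists>Gs epsi :: real.
           nm \<le> np \<and> c nm \<noteq> 0 \<and> 0 < Gs \<and> 0 < epsi \<and> epsi \<le> eps0 \<and>
           (\<forall>eps. 0 < eps \<and> eps \<le> epsi \<longrightarrow>
              \<bar>sm_stat N Q eps i - (\<Sum>l=nm..np. c l * eps ^ l)\<bar>
                \<le> Gs * eps powr (real np +
                     Min {min (dl i' j) (dld i' j) | i' j. i' \<in> {1..N} \<and> j \<in> Y i'}))"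
proof -
  define \<delta> where "\<delta> = Min {min (dl i' j) (dld i' j) | i' j. i' \<in> {1..N} \<and> j \<in> Y i'}"
  have "\<And>j k. j \<in> {1..N} \<Longrightarrow> k \<in> Y j \<Longrightarrow> 0 < dl j k \<and> dl j k \<le> 1 \<and> 0 < dld j k"
    using D E by blast
  with N have \<delta>: "0 < \<delta>" "\<delta> \<le> 1" "\<And>j k. j \<in> {1..N} \<Longrightarrow> k \<in> Y j \<Longrightarrow> \<delta> \<le> dl j k \<and> \<delta> \<le> dld j k"
    using min_exponent_bounds[where X = "{1..N}" and Y = Y and dl = dl and dld = dld, OF finite_atLeastAtMost]
      A_sub
    unfolding \<delta>_def by auto
  have asymp: "power_asymp \<delta> (\<lambda>x. smp Q x j k) \<and> power_asymp \<delta> (\<lambda>x. sme Q x j k)"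
    if "j \<in> {1..N}" "k \<in> Y j" for j k
  proof
    show "power_asymp \<delta> (\<lambda>x. smp Q x j k)"
      using D[OF that] \<delta>(1,2) \<delta>(3)[OF that]
      by (intro power_asymp_of_nat_expansion[where \<delta> = "dl j k" and e = "epsp j k" and a = "a j k"
            and G = "G j k" and m = "lm j k" and n = "lp j k"]) auto
    show "power_asymp \<delta> (\<lambda>x. sme Q x j k)"
      using E[OF that] \<delta>(1,2) \<delta>(3)[OF that]
      by (intro power_asymp_of_expansion[where \<delta> = "dld j k" and e = "epsd j k" and b = "b j k"
            and G = "Gd j k" and m = "mm j k" and n = "mp j k"]) auto
  qed
  have "pivotal_expansion \<delta> eps0 (\<lambda>x. sm_stat N Q x i)" if i: "i \<in> {1..N}" for i
  proof -
    note chain = eventually_hitting_chain_smp[OF finite_atLeastAtMost i eps0(1)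
        kern_sets kern_fin kern_pos kern_stoch A_sub A_a A_b A_c[OF _ i]]
    from power_asymp_stationary_prob[OF \<delta>(1,2) finite_atLeastAtMost i chain A_sub asymp]
    have "power_asymp \<delta> (\<lambda>x. sm_stat N Q x i)" and "\<forall>\<^sub>F x in at_right 0. sm_stat N Q x i \<le> 1"
      unfolding sm_stat_def sme_state_def sm_return_time_eq_hitting_time by blast+
    from power_asymp_bounded_imp_pivotal_expansion[OF \<delta>(1) this eps0(1)] show ?thesis .
  qed
  then show ?thesis
    unfolding pivotal_expansion_def \<delta>_def by blast
qed

end
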